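(* Let $0\to\mathfrak h\xrightarrow{i}\hat{\mathfrak g}\xrightarrow{p}\mathfrak g\to0$ be a non-abelian extension of Lie-Yamaguti algebras of $\mathfrak g$ by $\mathfrak h$ with a section $s$ of $p$, and let $(\chi,\omega,\mu,\theta,D,\rho,T)$ be the non-abelian $(2,3)$-cocycle induced by $s$. A pair $(\alpha,\beta)\in\mathrm{Aut}(\mathfrak g)\times\mathrm{Aut}(\mathfrak h)$ is extensible if and only if there is a linear map $\varphi:\mathfrak g\to\mathfrak h$ such that for all $x,y,z\in\mathfrak g$ and $a,b\in\mathfrak h$: $$\begin{aligned}\beta\omega(x,y,z)-\omega(\alpha(x),\alpha(y),\alpha(z))=\;&T(\alpha(z))(\varphi(x),\varphi(y))-\rho(\alpha(y))(\varphi(x),\varphi(z))-\theta(\alpha(y),\alpha(z))\varphi(x)\\&+\rho(\alpha(x))(\varphi(y),\varphi(z))+\theta(\alpha(x),\alpha(z))\varphi(y)-D(\alpha(x),\alpha(y))\varphi(z)\\&+\varphi(\{x,y,z\}_{\mathfrak g})-\{\varphi(x),\varphi(y),\varphi(z)\}_{\mathfrak h},\end{aligned}$$ $$\beta\chi(x,y)-\chi(\alpha(x),\alpha(y))=[\varphi(x),\varphi(y)]_{\mathfrak h}+\varphi([x,y]_{\mathfrak g})-\mu(\alpha(x))\varphi(y)+\mu(\alpha(y))\varphi(x),$$ $$\beta(\theta(x,y)a)-\theta(\alpha(x),\alpha(y))\beta(a)=\{\beta(a),\varphi(x),\varphi(y)\}_{\mathfrak h}-T(\alpha(y))(\beta(a),\varphi(x))+\rho(\alpha(x))(\beta(a),\varphi(y)),$$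 $$\beta D(x,y)a-D(\alpha(x),\alpha(y))\beta(a)=\{\varphi(x),\varphi(y),\beta(a)\}_{\mathfrak h}-\rho(\alpha(x))(\varphi(y),\beta(a))+\rho(\alpha(y))(\varphi(x),\beta(a)),$$ $$\beta(\rho(x)(a,b))-\rho(\alpha(x))(\beta(a),\beta(b))=\{\beta(a),\varphi(x),\beta(b)\}_{\mathfrak h},$$ $$\beta T(x)(a,b)-T(\alpha(x))(\beta(a),\beta(b))=\{\beta(b),\beta(a),\varphi(x)\}_{\mathfrak h},$$ $$\beta\mu(x)a-\mu(\alpha(x))\beta(a)=[\beta(a),\varphi(x)]_{\mathfrak h}.$$
   Context: All vector spaces and algebras are over a field $k$. A Lie-Yamaguti algebra is a vector space $\mathfrak g$ with a bilinear map $[\cdot,\cdot]$ and a trilinear map $\{\cdot,\cdot,\cdot\}$ such that for all elements $[x_1,x_2]+[x_2,x_1]=0$, $\{x_1,x_2,x_3\}+\{x_2,x_1,x_3\}=0$; $[[x_1,x_2],x_3]+[[x_2,x_3],x_1]+[[x_3,x_1],x_2]+\{x_1,x_2,x_3\}+\{x_2,x_3,x_1\}+\{x_3,x_1,x_2\}=0$; $\{[x_1,x_2],x_3,y_1\}+\{[x_2,x_3],x_1,y_1\}+\{[x_3,x_1],x_2,y_1\}=0$; $\{x_1,x_2,[y_1,y_2]\}=[\{x_1,x_2,y_1\},y_2]+[y_1,\{x_1,x_2,y_2\}]$; $\{x_1,x_2,\{y_1,y_2,y_3\}\}=\{\{x_1,x_2,y_1\},y_2,y_3\}+\{y_1,\{x_1,x_2,y_2\},y_3\}+\{y_1,y_2,\{x_1,x_2,y_3\}\}$.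 Homomorphisms are linear maps preserving both operations; $\mathrm{Aut}$ denotes the group of automorphisms. A non-abelian extension of $\mathfrak g$ by $\mathfrak h$ is a short exact sequence of Lie-Yamaguti algebras $0\to\mathfrak h\xrightarrow{i}\hat{\mathfrak g}\xrightarrow{p}\mathfrak g\to0$; $\mathfrak h$ is identified with $i(\mathfrak h)$. A section of $p$ is a linear map $s:\mathfrak g\to\hat{\mathfrak g}$ with $ps=I_{\mathfrak g}$. The non-abelian $(2,3)$-cocycle induced by $s$ is the septuple of maps given, for $x,y,z\in\mathfrak g$, $a,b\in\mathfrak h$, by $\chi(x,y)=[s(x),s(y)]_{\hat{\mathfrak g}}-s[x,y]_{\mathfrak g}$, $\omega(x,y,z)=\{s(x),s(y),s(z)\}_{\hat{\mathfrak g}}-s\{x,y,z\}_{\mathfrak g}$, $\mu(x)a=[s(x),a]_{\hat{\mathfrak g}}$, $\theta(x,y)a=\{a,s(x),s(y)\}_{\hat{\mathfrak g}}$, $D(x,y)a=\{s(x),s(y),a\}_{\hat{\mathfrak g}}$, $\rho(x)(a,b)=\{s(x),a,b\}_{\hat{\mathfrak g}}$, $T(x)(a,b)=\{a,b,s(x)\}_{\hat{\mathfrak g}}$ (all with values in $\mathfrak h$). Let $\mathrm{Aut}_{\mathfrak h}(\hat{\mathfrak g})=\{\gamma\in\mathrm{Aut}(\hat{\mathfrak g})\mid\gamma(\mathfrak h)=\mathfrak h\}$. A pair $(\alpha,\beta)\in\mathrm{Aut}(\mathfrak g)\times\mathrm{Aut}(\mathfrak h)$ is extensible (with respect to the extension)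 if there is $\gamma\in\mathrm{Aut}_{\mathfrak h}(\hat{\mathfrak g})$ with $i\beta=\gamma i$ and $p\gamma=\alpha p$. *)

theory Defs
  imports Complex_Main
begin

text \<open>
  The underlying vector space is the whole type, with addition from the class
  \<^class>\<open>ab_group_add\<close>; the record carries the scalar multiplication and the two operations.
\<close>

record ('k, 'a) lya =
  scal :: "'k \<Rightarrow> 'a \<Rightarrow> 'a"
  bracket :: "'a \<Rightarrow> 'a \<Rightarrow> 'a"
  triple :: "'a \<Rightarrow> 'a \<Rightarrow> 'a \<Rightarrow> 'a"

locale lie_yamaguti_algebra =
  fixes L :: "('k::field, 'a::ab_group_add) lya"
  assumes vector_space: "vector_space (scal L)"
    and bracket_linear_left: "Vector_Spaces.linear (scal L) (scal L) (\<lambda>x. bracket L x y)"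
    and bracket_linear_right: "Vector_Spaces.linear (scal L) (scal L) (\<lambda>y. bracket L x y)"
    and triple_linear_1: "Vector_Spaces.linear (scal L) (scal L) (\<lambda>x. triple L x y z)"
    and triple_linear_2: "Vector_Spaces.linear (scal L) (scal L) (\<lambda>y. triple L x y z)"
    and triple_linear_3: "Vector_Spaces.linear (scal L) (scal L) (\<lambda>z. triple L x y z)"
    and bracket_skew: "bracket L x y + bracket L y x = 0"
    and triple_skew: "triple L x y z + triple L y x z = 0"
    and jacobi:
      "bracket L (bracket L x y) z + bracket L (bracket L y z) x + bracket L (bracket L z x) y
        + triple L x y z + triple L y z x + triple L z x y = 0"
    and bracket_triple_cyclic:
      "triple L (bracket L x y) z u + triple L (bracket L y z) x u
        + triple L (bracket L z x) y u = 0"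
    and triple_bracket:
      "triple L x y (bracket L u v) =
        bracket L (triple L x y u) v + bracket L u (triple L x y v)"
    and triple_triple:
      "triple L x y (triple L u v w) =
        triple L (triple L x y u) v w + triple L u (triple L x y v) w
          + triple L u v (triple L x y w)"

definition ly_hom ::
  "('k::field, 'a::ab_group_add) lya \<Rightarrow> ('k, 'b::ab_group_add) lya \<Rightarrow> ('a \<Rightarrow> 'b) \<Rightarrow> bool" where
  "ly_hom L M f \<longleftrightarrow>
     Vector_Spaces.linear (scal L) (scal M) f \<and>
     (\<forall>x y. f (bracket L x y) = bracket M (f x) (f y)) \<and>
     (\<forall>x y z. f (triple L x y z) = triple M (f x) (f y) (f z))"

definition ly_aut :: "('k::field, 'a::ab_group_add) lya \<Rightarrow> ('a \<Rightarrow> 'a) set" where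
  "ly_aut L = {f. ly_hom L L f \<and> bij f}"

locale ly_extension =
  H: lie_yamaguti_algebra H + E: lie_yamaguti_algebra E + G: lie_yamaguti_algebra G
  for H :: "('k::field, 'h::ab_group_add) lya"
    and E :: "('k, 'e::ab_group_add) lya"
    and G :: "('k, 'g::ab_group_add) lya"
    and i :: "'h \<Rightarrow> 'e" and p :: "'e \<Rightarrow> 'g" +
  assumes hom_i: "ly_hom H E i"
    and hom_p: "ly_hom E G p"
    and inj_i: "inj i"
    and exact: "range i = {e. p e = 0}"
    and surj_p: "surj p"

definition ly_section ::
  "('k::field, 'e::ab_group_add) lya \<Rightarrow> ('k, 'g::ab_group_add) lya \<Rightarrow>
    ('e \<Rightarrow> 'g) \<Rightarrow> ('g \<Rightarrow> 'e) \<Rightarrow> bool" where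
  "ly_section E G p s \<longleftrightarrow> Vector_Spaces.linear (scal G) (scal E) s \<and> p \<circ> s = id"

text \<open>
  The septuple induced by a section, in the order
  \<open>(\<chi>, \<omega>, \<mu>, \<theta>, D, \<rho>, T)\<close>. The identification of the kernel \<open>\<hh>\<close> with its image under
  the embedding \<open>i\<close> is made explicit: arguments from \<open>\<hh>\<close> are mapped by \<open>i\<close>, and results,
  which lie in the range of \<open>i\<close> (see the lemma below), are pulled back by \<open>inv i\<close>.
\<close>

definition induced_cocycle ::
  "('k::field, 'e::ab_group_add) lya \<Rightarrow> ('k, 'g::ab_group_add) lya \<Rightarrow>
    ('h::ab_group_add \<Rightarrow> 'e) \<Rightarrow> ('g \<Rightarrow> 'e) \<Rightarrow>
    ('g \<Rightarrow> 'g \<Rightarrow> 'h) \<times> ('g \<Rightarrow> 'g \<Rightarrow> 'g \<Rightarrow> 'h) \<times> ('g \<Rightarrow> 'h \<Rightarrow> 'h) \<times>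
    ('g \<Rightarrow> 'g \<Rightarrow> 'h \<Rightarrow> 'h) \<times> ('g \<Rightarrow> 'g \<Rightarrow> 'h \<Rightarrow> 'h) \<times>
    ('g \<Rightarrow> 'h \<Rightarrow> 'h \<Rightarrow> 'h) \<times> ('g \<Rightarrow> 'h \<Rightarrow> 'h \<Rightarrow> 'h)" where
  "induced_cocycle E G i s =
    (\<lambda>x y. inv i (bracket E (s x) (s y) - s (bracket G x y)),
     \<lambda>x y z. inv i (triple E (s x) (s y) (s z) - s (triple G x y z)),
     \<lambda>x a. inv i (bracket E (s x) (i a)),
     \<lambda>x y a. inv i (triple E (i a) (s x) (s y)),
     \<lambda>x y a. inv i (triple E (s x) (s y) (i a)),
     \<lambda>x a b. inv i (triple E (s x) (i a) (i b)),
     \<lambda>x a b. inv i (triple E (i a) (i b) (s x)))"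

lemma induced_cocycle_embed:
  assumes "ly_extension H E G i p" and "ly_section E G p s"
    and "(\<chi>, \<omega>, \<mu>, \<theta>, D, \<rho>, T) = induced_cocycle E G i s"
  shows "i (\<chi> x y) = bracket E (s x) (s y) - s (bracket G x y)"
    and "i (\<omega> x y z) = triple E (s x) (s y) (s z) - s (triple G x y z)"
    and "i (\<mu> x a) = bracket E (s x) (i a)"
    and "i (\<theta> x y a) = triple E (i a) (s x) (s y)"
    and "i (D x y a) = triple E (s x) (s y) (i a)"
    and "i (\<rho> x a b) = triple E (s x) (i a) (i b)"
    and "i (T x a b) = triple E (i a) (i b) (s x)"
proof -
  interpret ly_extension H E G i p by fact
  interpret p: Vector_Spaces.linear "scal E" "scal G" p
    using hom_p by (simp add: ly_hom_def)
  note lin0 = module_hom.zero[OF Vector_Spaces.linear.axioms(3)]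
  have ps: "p (s x) = x" for x
    using assms(2) by (metis comp_apply id_apply ly_section_def)
  have pi0: "p (i a) = 0" for a
    using exact by auto
  have pull: "i (inv i e) = e" if "p e = 0" for e
    using that exact by (metis (mono_tags, lifting) f_inv_into_f mem_Collect_eq)
  have hb: "p (bracket E x y) = bracket G (p x) (p y)"
    and ht: "p (triple E x y z) = triple G (p x) (p y) (p z)" for x y z
    using hom_p by (auto simp: ly_hom_def)
  note zeros = lin0[OF G.bracket_linear_right] lin0[OF G.triple_linear_1]
    lin0[OF G.triple_linear_3]
  note eqs = p.diff hb ht ps pi0 zeros
  show "i (\<chi> x y) = bracket E (s x) (s y) - s (bracket G x y)"
    and "i (\<omega> x y z) = triple E (s x) (s y) (s z) - s (triple G x y z)"
    and "i (\<mu> x a) = bracket E (s x) (i a)"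
    and "i (\<theta> x y a) = triple E (i a) (s x) (s y)"
    and "i (D x y a) = triple E (s x) (s y) (i a)"
    and "i (\<rho> x a b) = triple E (s x) (i a) (i b)"
    and "i (T x a b) = triple E (i a) (i b) (s x)"
    using assms(3) by (auto simp: induced_cocycle_def intro!: pull simp: eqs)
qed

definition ly_aut_preserving ::
  "('k::field, 'e::ab_group_add) lya \<Rightarrow> 'e set \<Rightarrow> ('e \<Rightarrow> 'e) set" where
  "ly_aut_preserving E S = {\<gamma> \<in> ly_aut E. \<gamma> ` S = S}"

definition extensible ::
  "('k::field, 'e::ab_group_add) lya \<Rightarrow> ('h \<Rightarrow> 'e) \<Rightarrow> ('e \<Rightarrow> 'g) \<Rightarrow>
    ('g \<Rightarrow> 'g) \<times> ('h \<Rightarrow> 'h) \<Rightarrow> bool" where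
  "extensible E i p = (\<lambda>(\<alpha>, \<beta>).
     \<exists>\<gamma> \<in> ly_aut_preserving E (range i). i \<circ> \<beta> = \<gamma> \<circ> i \<and> p \<circ> \<gamma> = \<alpha> \<circ> p)"

end

theory Submission
  imports Defs
begin

text \<open>
  As a vector space the middle algebra is the direct sum of \<open>s(\<gg>)\<close> and \<open>i(\<hh>)\<close>. A linear map
  \<open>\<gamma>\<close> with \<open>\<gamma> i = i \<beta>\<close> and \<open>p \<gamma> = \<alpha> p\<close> therefore amounts to a linear map
  \<open>\<phi> : \<gg> \<rightarrow> \<hh>\<close> through \<open>\<gamma> (s x) = s (\<alpha> x) - i (\<phi> x)\<close>, because \<open>\<gamma> (s x)\<close> and
  \<open>s (\<alpha> x)\<close> have the same image under \<open>p\<close>. Such a \<open>\<gamma>\<close> is always bijective, by the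
  argument of the short five lemma.

  It remains to see when \<open>\<gamma>\<close> preserves the operations. By multilinearity and skew symmetry this
  only needs to be tested on arguments of the form \<open>s x\<close> and \<open>i a\<close>, in one order for each type.
  If all arguments are in \<open>i(\<hh>)\<close> the test is that \<open>\<beta>\<close> is a homomorphism. The remaining seven
  types are those by which the components of the cocycle are defined, and for each of them the
  defect \<open>\<gamma>(operation) - operation(\<gamma>)\<close> is the image under \<open>i\<close> of the difference of the two
  sides of the corresponding equation (lemmas \<open>defect_chi\<close> to \<open>defect_T\<close>). As \<open>i\<close> is injective,
  the seven equations together say that \<open>\<gamma>\<close> is a homomorphism.
\<close>

section \<open>Multilinearity and skew symmetry of the operations\<close>

context lie_yamaguti_algebra
begin

lemmas scal_add = vector_space.vector_space_assms(1)[OF vector_space]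

lemmas scal_diff = module.scale_right_diff_distrib[OF vector_space[folded module_iff_vector_space]]

lemma bracket_add_left: "bracket L (x + x') y = bracket L x y + bracket L x' y"
  using bracket_linear_left by (auto simp: Vector_Spaces.linear_iff)

lemma bracket_add_right: "bracket L x (y + y') = bracket L x y + bracket L x y'"
  using bracket_linear_right by (auto simp: Vector_Spaces.linear_iff)

lemma triple_add_1: "triple L (x + x') y z = triple L x y z + triple L x' y z"
  using triple_linear_1 by (auto simp: Vector_Spaces.linear_iff)

lemma triple_add_2: "triple L x (y + y') z = triple L x y z + triple L x y' z"
  using triple_linear_2 by (auto simp: Vector_Spaces.linear_iff)

lemma triple_add_3: "triple L x y (z + z') = triple L x y z + triple L x y z'"
  using triple_linear_3 by (auto simp: Vector_Spaces.linear_iff)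

lemma bracket_diff_left: "bracket L (x - x') y = bracket L x y - bracket L x' y"
  using bracket_add_left[of "x - x'" x' y] by (simp add: algebra_simps)

lemma bracket_diff_right: "bracket L x (y - y') = bracket L x y - bracket L x y'"
  using bracket_add_right[of x "y - y'" y'] by (simp add: algebra_simps)

lemma triple_diff_1: "triple L (x - x') y z = triple L x y z - triple L x' y z"
  using triple_add_1[of "x - x'" x' y z] by (simp add: algebra_simps)

lemma triple_diff_2: "triple L x (y - y') z = triple L x y z - triple L x y' z"
  using triple_add_2[of x "y - y'" y' z] by (simp add: algebra_simps)

lemma triple_diff_3: "triple L x y (z - z') = triple L x y z - triple L x y z'"
  using triple_add_3[of x y "z - z'" z'] by (simp add: algebra_simps)

lemmas add_simps = bracket_add_left bracket_add_right triple_add_1 triple_add_2 triple_add_3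

lemmas diff_simps = bracket_diff_left bracket_diff_right triple_diff_1 triple_diff_2 triple_diff_3

lemma bracket_swap: "bracket L x y = - bracket L y x"
  using bracket_skew[of x y] by (simp add: eq_neg_iff_add_eq_0)

lemma triple_swap: "triple L x y z = - triple L y x z"
  using triple_skew[of x y z] by (simp add: eq_neg_iff_add_eq_0)

end

section \<open>Extensions with a chosen section\<close>

text \<open>
  An extension with a section, its induced cocycle, and a pair \<open>(\<alpha>, \<beta>)\<close> of automorphisms.
\<close>

locale ly_extension_pair = ly_extension H E G i p
  for H :: "('k::field, 'h::ab_group_add) lya"
    and E :: "('k, 'e::ab_group_add) lya"
    and G :: "('k, 'g::ab_group_add) lya"
    and i :: "'h \<Rightarrow> 'e" and p :: "'e \<Rightarrow> 'g" +
  fixes s :: "'g \<Rightarrow> 'e" and \<chi> \<omega> \<mu> \<theta> D \<rho> T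
    and \<alpha> :: "'g \<Rightarrow> 'g" and \<beta> :: "'h \<Rightarrow> 'h"
  assumes section_s: "ly_section E G p s"
    and cocycle: "(\<chi>, \<omega>, \<mu>, \<theta>, D, \<rho>, T) = induced_cocycle E G i s"
    and aut_\<alpha>: "\<alpha> \<in> ly_aut G" and aut_\<beta>: "\<beta> \<in> ly_aut H"
begin

lemmas embed = induced_cocycle_embed[OF ly_extension_axioms section_s cocycle]

sublocale i: Vector_Spaces.linear "scal H" "scal E" i
  using hom_i by (simp add: ly_hom_def)
sublocale p: Vector_Spaces.linear "scal E" "scal G" p
  using hom_p by (simp add: ly_hom_def)
sublocale s: Vector_Spaces.linear "scal G" "scal E" s
  using section_s by (simp add: ly_section_def)
sublocale \<alpha>: Vector_Spaces.linear "scal G" "scal G" \<alpha>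
  using aut_\<alpha> by (simp add: ly_aut_def ly_hom_def)
sublocale \<beta>: Vector_Spaces.linear "scal H" "scal H" \<beta>
  using aut_\<beta> by (simp add: ly_aut_def ly_hom_def)

lemma bij_\<alpha>: "bij \<alpha>" and bij_\<beta>: "bij \<beta>"
  using aut_\<alpha> aut_\<beta> by (simp_all add: ly_aut_def)

lemma i_bracket: "i (bracket H a b) = bracket E (i a) (i b)"
  and i_triple: "i (triple H a b c) = triple E (i a) (i b) (i c)"
  using hom_i by (simp_all add: ly_hom_def)

lemma \<alpha>_bracket: "\<alpha> (bracket G x y) = bracket G (\<alpha> x) (\<alpha> y)"
  and \<alpha>_triple: "\<alpha> (triple G x y z) = triple G (\<alpha> x) (\<alpha> y) (\<alpha> z)"
  using aut_\<alpha> by (simp_all add: ly_aut_def ly_hom_def)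

lemma \<beta>_bracket: "\<beta> (bracket H a b) = bracket H (\<beta> a) (\<beta> b)"
  and \<beta>_triple: "\<beta> (triple H a b c) = triple H (\<beta> a) (\<beta> b) (\<beta> c)"
  using aut_\<beta> by (simp_all add: ly_aut_def ly_hom_def)

lemma p_s [simp]: "p (s x) = x"
  using section_s by (metis comp_apply id_apply ly_section_def)

lemma p_i [simp]: "p (i a) = 0"
  using exact by auto

lemma i_inv_i: "p e = 0 \<Longrightarrow> i (inv i e) = e"
  using exact by (metis (mono_tags, lifting) f_inv_into_f mem_Collect_eq)

lemma i_eq_iff: "i a = i b \<longleftrightarrow> a = b"
  using inj_i by (simp add: inj_eq)

lemma decomposition: obtains x a where "e = s x + i a"
  using i_inv_i[of "e - s (p e)"] that[of "p e" "inv i (e - s (p e))"]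
  by (simp add: p.diff algebra_simps)

text \<open>
  The seven equations by which a map \<open>\<phi> : \<gg> \<rightarrow> \<hh>\<close> makes \<open>\<beta>\<close> applied to the cocycle agree with
  the cocycle evaluated at \<open>\<alpha>\<close>- and \<open>\<beta>\<close>-transformed arguments, up to correction terms in \<open>\<phi>\<close>.
  Linearity of \<open>\<phi>\<close> is not part of this condition.
\<close>

definition compatible :: "('g \<Rightarrow> 'h) \<Rightarrow> bool" where
  "compatible \<phi> \<longleftrightarrow> (\<forall>x y z a b.
      \<beta> (\<omega> x y z) - \<omega> (\<alpha> x) (\<alpha> y) (\<alpha> z) =
        T (\<alpha> z) (\<phi> x) (\<phi> y) - \<rho> (\<alpha> y) (\<phi> x) (\<phi> z) - \<theta> (\<alpha> y) (\<alpha> z) (\<phi> x)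
        + \<rho> (\<alpha> x) (\<phi> y) (\<phi> z) + \<theta> (\<alpha> x) (\<alpha> z) (\<phi> y) - D (\<alpha> x) (\<alpha> y) (\<phi> z)
        + \<phi> (triple G x y z) - triple H (\<phi> x) (\<phi> y) (\<phi> z) \<and>
      \<beta> (\<chi> x y) - \<chi> (\<alpha> x) (\<alpha> y) =
        bracket H (\<phi> x) (\<phi> y) + \<phi> (bracket G x y) - \<mu> (\<alpha> x) (\<phi> y) + \<mu> (\<alpha> y) (\<phi> x) \<and>
      \<beta> (\<theta> x y a) - \<theta> (\<alpha> x) (\<alpha> y) (\<beta> a) =
        triple H (\<beta> a) (\<phi> x) (\<phi> y) - T (\<alpha> y) (\<beta> a) (\<phi> x) + \<rho> (\<alpha> x) (\<beta> a) (\<phi> y) \<and>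
      \<beta> (D x y a) - D (\<alpha> x) (\<alpha> y) (\<beta> a) =
        triple H (\<phi> x) (\<phi> y) (\<beta> a) - \<rho> (\<alpha> x) (\<phi> y) (\<beta> a) + \<rho> (\<alpha> y) (\<phi> x) (\<beta> a) \<and>
      \<beta> (\<rho> x a b) - \<rho> (\<alpha> x) (\<beta> a) (\<beta> b) = triple H (\<beta> a) (\<phi> x) (\<beta> b) \<and>
      \<beta> (T x a b) - T (\<alpha> x) (\<beta> a) (\<beta> b) = triple H (\<beta> b) (\<beta> a) (\<phi> x) \<and>
      \<beta> (\<mu> x a) - \<mu> (\<alpha> x) (\<beta> a) = bracket H (\<beta> a) (\<phi> x))"

end

section \<open>Lifts and their defects\<close>

text \<open>
  A linear map \<open>\<gamma>\<close> that is \<open>\<beta>\<close> on the kernel and \<open>s \<alpha> - i \<phi>\<close> on the image of the section; it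
  then lies over \<open>\<alpha>\<close> (lemma \<open>p_\<gamma>\<close>). It need not preserve the operations. The sign of \<open>\<phi>\<close> is
  chosen to match the equations in \<open>compatible\<close>.
\<close>

locale ly_lift = ly_extension_pair H E G i p s \<chi> \<omega> \<mu> \<theta> D \<rho> T \<alpha> \<beta>
  for H :: "('k::field, 'h::ab_group_add) lya"
    and E :: "('k, 'e::ab_group_add) lya"
    and G :: "('k, 'g::ab_group_add) lya"
    and i p s \<chi> \<omega> \<mu> \<theta> D \<rho> T \<alpha> \<beta> +
  fixes \<phi> :: "'g \<Rightarrow> 'h" and \<gamma> :: "'e \<Rightarrow> 'e"
  assumes linear_\<gamma>: "Vector_Spaces.linear (scal E) (scal E) \<gamma>"
    and \<gamma>_i: "\<gamma> (i a) = i (\<beta> a)"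
    and \<gamma>_s: "\<gamma> (s x) = s (\<alpha> x) - i (\<phi> x)"
begin

sublocale \<gamma>: Vector_Spaces.linear "scal E" "scal E" \<gamma>
  by (rule linear_\<gamma>)

lemma p_\<gamma>: "p (\<gamma> e) = \<alpha> (p e)"
  by (rule decomposition[of e]) (simp add: \<gamma>.add \<gamma>_i \<gamma>_s p.add p.diff)

lemma bij_\<gamma>: "bij \<gamma>"
proof (rule bijI)
  show "inj \<gamma>"
    unfolding \<gamma>.inj_iff_eq_0
  proof (intro allI impI)
    fix e assume e: "\<gamma> e = 0"
    then have "\<alpha> (p e) = \<alpha> 0"
      by (metis p_\<gamma> p.zero \<alpha>.zero)
    then have "p e = 0"
      by (rule injD[OF bij_is_inj[OF bij_\<alpha>]])
    then obtain a where a: "e = i a"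
      using i_inv_i by metis
    with e have "i (\<beta> a) = i (\<beta> 0)"
      by (simp add: \<gamma>_i)
    then have "a = 0"
      unfolding i_eq_iff by (rule injD[OF bij_is_inj[OF bij_\<beta>]])
    then show "e = 0"
      by (simp add: a)
  qed
  show "surj \<gamma>"
    unfolding surj_def
  proof
    fix e
    obtain x where x: "p e = \<alpha> x"
      using bij_\<alpha> by (metis bij_pointE)
    then have "p (e - \<gamma> (s x)) = 0"
      by (simp add: p.diff p_\<gamma>)
    then obtain b where b: "e - \<gamma> (s x) = i b"
      using i_inv_i by metis
    obtain a where "b = \<beta> a"
      using bij_\<beta> by (metis bij_pointE)
    with b have "e = \<gamma> (s x + i a)"
      by (simp add: \<gamma>.add \<gamma>_i algebra_simps)
    then show "\<exists>e'. e = \<gamma> e'" ..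
  qed
qed

lemma \<gamma>_image: "\<gamma> ` range i = range i"
proof -
  have "\<gamma> ` range i = i ` range \<beta>"
    by (simp add: image_image \<gamma>_i)
  then show ?thesis
    using bij_\<beta> by (simp add: bij_def)
qed

text \<open>
  The swaps that bring every mixed product into the order used by the cocycle.
\<close>

lemma swaps:
  "bracket E (i a) (s x) = - bracket E (s x) (i a)"
  "triple E (s x) (i a) (s y) = - triple E (i a) (s x) (s y)"
  "triple E (i a) (s x) (i b) = - triple E (s x) (i a) (i b)"
  by (rule E.bracket_swap, rule E.triple_swap, rule E.triple_swap)

lemma \<gamma>_s_bracket:
  "\<gamma> (bracket E (s x) (s y)) = i (\<beta> (\<chi> x y)) + s (bracket G (\<alpha> x) (\<alpha> y)) - i (\<phi> (bracket G x y))"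
proof -
  have "bracket E (s x) (s y) = i (\<chi> x y) + s (bracket G x y)"
    by (simp add: embed)
  then show ?thesis
    by (simp add: \<gamma>.add \<gamma>_i \<gamma>_s \<alpha>_bracket)
qed

lemma \<gamma>_s_triple:
  "\<gamma> (triple E (s x) (s y) (s z)) =
    i (\<beta> (\<omega> x y z)) + s (triple G (\<alpha> x) (\<alpha> y) (\<alpha> z)) - i (\<phi> (triple G x y z))"
proof -
  have "triple E (s x) (s y) (s z) = i (\<omega> x y z) + s (triple G x y z)"
    by (simp add: embed)
  then show ?thesis
    by (simp add: \<gamma>.add \<gamma>_i \<gamma>_s \<alpha>_triple)
qed

lemma \<gamma>_mixed:
  "\<gamma> (bracket E (s x) (i a)) = i (\<beta> (\<mu> x a))"
  "\<gamma> (triple E (i a) (s x) (s y)) = i (\<beta> (\<theta> x y a))"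
  "\<gamma> (triple E (s x) (s y) (i a)) = i (\<beta> (D x y a))"
  "\<gamma> (triple E (s x) (i a) (i b)) = i (\<beta> (\<rho> x a b))"
  "\<gamma> (triple E (i a) (i b) (s x)) = i (\<beta> (T x a b))"
  by (simp_all flip: embed \<gamma>_i)

lemmas expand = \<gamma>_s_bracket \<gamma>_s_triple \<gamma>_mixed \<gamma>_i \<gamma>_s E.diff_simps i.add i.diff i.neg
  i_bracket i_triple embed swaps

lemma defect_chi:
  "\<gamma> (bracket E (s x) (s y)) - bracket E (\<gamma> (s x)) (\<gamma> (s y)) =
    i (\<beta> (\<chi> x y) - \<chi> (\<alpha> x) (\<alpha> y) -
      (bracket H (\<phi> x) (\<phi> y) + \<phi> (bracket G x y) - \<mu> (\<alpha> x) (\<phi> y) + \<mu> (\<alpha> y) (\<phi> x)))"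
  by (simp add: expand algebra_simps)

lemma defect_omega:
  "\<gamma> (triple E (s x) (s y) (s z)) - triple E (\<gamma> (s x)) (\<gamma> (s y)) (\<gamma> (s z)) =
    i (\<beta> (\<omega> x y z) - \<omega> (\<alpha> x) (\<alpha> y) (\<alpha> z) -
      (T (\<alpha> z) (\<phi> x) (\<phi> y) - \<rho> (\<alpha> y) (\<phi> x) (\<phi> z) - \<theta> (\<alpha> y) (\<alpha> z) (\<phi> x)
        + \<rho> (\<alpha> x) (\<phi> y) (\<phi> z) + \<theta> (\<alpha> x) (\<alpha> z) (\<phi> y) - D (\<alpha> x) (\<alpha> y) (\<phi> z)
        + \<phi> (triple G x y z) - triple H (\<phi> x) (\<phi> y) (\<phi> z)))"
  by (simp add: expand algebra_simps)

lemma defect_mu: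
  "\<gamma> (bracket E (s x) (i a)) - bracket E (\<gamma> (s x)) (\<gamma> (i a)) =
    i (\<beta> (\<mu> x a) - \<mu> (\<alpha> x) (\<beta> a) - bracket H (\<beta> a) (\<phi> x))"
  using E.bracket_swap[of "i (\<beta> a)" "i (\<phi> x)"] by (simp add: expand algebra_simps)

lemma defect_theta:
  "\<gamma> (triple E (i a) (s x) (s y)) - triple E (\<gamma> (i a)) (\<gamma> (s x)) (\<gamma> (s y)) =
    i (\<beta> (\<theta> x y a) - \<theta> (\<alpha> x) (\<alpha> y) (\<beta> a) -
      (triple H (\<beta> a) (\<phi> x) (\<phi> y) - T (\<alpha> y) (\<beta> a) (\<phi> x) + \<rho> (\<alpha> x) (\<beta> a) (\<phi> y)))"
  by (simp add: expand algebra_simps)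

lemma defect_D:
  "\<gamma> (triple E (s x) (s y) (i a)) - triple E (\<gamma> (s x)) (\<gamma> (s y)) (\<gamma> (i a)) =
    i (\<beta> (D x y a) - D (\<alpha> x) (\<alpha> y) (\<beta> a) -
      (triple H (\<phi> x) (\<phi> y) (\<beta> a) - \<rho> (\<alpha> x) (\<phi> y) (\<beta> a) + \<rho> (\<alpha> y) (\<phi> x) (\<beta> a)))"
  by (simp add: expand algebra_simps)

lemma defect_rho:
  "\<gamma> (triple E (s x) (i a) (i b)) - triple E (\<gamma> (s x)) (\<gamma> (i a)) (\<gamma> (i b)) =
    i (\<beta> (\<rho> x a b) - \<rho> (\<alpha> x) (\<beta> a) (\<beta> b) - triple H (\<beta> a) (\<phi> x) (\<beta> b))"
  using E.triple_swap[of "i (\<beta> a)" "i (\<phi> x)"] by (simp add: expand algebra_simps)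

lemma defect_T:
  "\<gamma> (triple E (i a) (i b) (s x)) - triple E (\<gamma> (i a)) (\<gamma> (i b)) (\<gamma> (s x)) =
    i (\<beta> (T x a b) - T (\<alpha> x) (\<beta> a) (\<beta> b) - triple H (\<beta> b) (\<beta> a) (\<phi> x))"
  using E.triple_swap[of "i (\<beta> b)" "i (\<beta> a)"] by (simp add: expand algebra_simps)

lemma i_diff_eq_0_iff: "i (a - b) = 0 \<longleftrightarrow> a = b"
  using i_eq_iff[of "a - b" 0] by simp

lemma compatible_if_hom:
  assumes "ly_hom E E \<gamma>"
  shows "compatible \<phi>"
proof -
  have "\<gamma> (bracket E u v) - bracket E (\<gamma> u) (\<gamma> v) = 0"
    and "\<gamma> (triple E u v w) - triple E (\<gamma> u) (\<gamma> v) (\<gamma> w) = 0" for u v w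
    using assms by (simp_all add: ly_hom_def)
  note defects = defect_chi defect_omega defect_mu defect_theta defect_D defect_rho defect_T
  show ?thesis
    unfolding compatible_def
    by (intro allI conjI; rule iffD1[OF i_diff_eq_0_iff], unfold defects[symmetric]) fact+
qed

lemma hom_if_compatible:
  assumes "compatible \<phi>"
  shows "ly_hom E E \<gamma>"
proof -
  note eqs = assms[unfolded compatible_def, rule_format]
  have ss: "\<gamma> (bracket E (s x) (s y)) = bracket E (\<gamma> (s x)) (\<gamma> (s y))"
    and si: "\<gamma> (bracket E (s x) (i a)) = bracket E (\<gamma> (s x)) (\<gamma> (i a))"
    and sss: "\<gamma> (triple E (s x) (s y) (s z)) = triple E (\<gamma> (s x)) (\<gamma> (s y)) (\<gamma> (s z))"
    and iss: "\<gamma> (triple E (i a) (s x) (s y)) = triple E (\<gamma> (i a)) (\<gamma> (s x)) (\<gamma> (s y))"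
    and ssi: "\<gamma> (triple E (s x) (s y) (i a)) = triple E (\<gamma> (s x)) (\<gamma> (s y)) (\<gamma> (i a))"
    and sii: "\<gamma> (triple E (s x) (i a) (i b)) = triple E (\<gamma> (s x)) (\<gamma> (i a)) (\<gamma> (i b))"
    and iis: "\<gamma> (triple E (i a) (i b) (s x)) = triple E (\<gamma> (i a)) (\<gamma> (i b)) (\<gamma> (s x))"
    for x y z a b
    using eqs[of x y z a b] defect_chi[of x y] defect_mu[of x a] defect_omega[of x y z]
      defect_theta[of a x y] defect_D[of x y a] defect_rho[of x a b] defect_T[of a b x]
    by simp_all
  have ii: "\<gamma> (bracket E (i a) (i b)) = bracket E (\<gamma> (i a)) (\<gamma> (i b))" for a b
    by (simp add: \<gamma>_i \<beta>_bracket flip: i_bracket)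
  have iii: "\<gamma> (triple E (i a) (i b) (i c)) = triple E (\<gamma> (i a)) (\<gamma> (i b)) (\<gamma> (i c))" for a b c
    by (simp add: \<gamma>_i \<beta>_triple flip: i_triple)
  have is': "\<gamma> (bracket E (i a) (s x)) = bracket E (\<gamma> (i a)) (\<gamma> (s x))" for x a
    using si[of x a] E.bracket_swap[of "i a" "s x"] E.bracket_swap[of "\<gamma> (i a)" "\<gamma> (s x)"]
    by (simp add: \<gamma>.neg)
  have sis: "\<gamma> (triple E (s x) (i a) (s y)) = triple E (\<gamma> (s x)) (\<gamma> (i a)) (\<gamma> (s y))" for x y a
    using iss[of a x y] E.triple_swap[of "s x" "i a"] E.triple_swap[of "\<gamma> (s x)" "\<gamma> (i a)"]
    by (simp add: \<gamma>.neg)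
  have isi: "\<gamma> (triple E (i a) (s x) (i b)) = triple E (\<gamma> (i a)) (\<gamma> (s x)) (\<gamma> (i b))" for x a b
    using sii[of x a b] E.triple_swap[of "i a" "s x"] E.triple_swap[of "\<gamma> (i a)" "\<gamma> (s x)"]
    by (simp add: \<gamma>.neg)
  \<comment> \<open>Decomposing the arguments, each operation splits into the four or eight types above.\<close>
  have "\<gamma> (bracket E u v) = bracket E (\<gamma> u) (\<gamma> v)" for u v
    by (rule decomposition[of u], rule decomposition[of v])
      (simp only: \<gamma>.add E.add_simps ss si is' ii)
  moreover have "\<gamma> (triple E u v w) = triple E (\<gamma> u) (\<gamma> v) (\<gamma> w)" for u v w
    by (rule decomposition[of u], rule decomposition[of v], rule decomposition[of w])
      (simp only: \<gamma>.add E.add_simps sss iss sis ssi sii isi iis iii)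
  ultimately show ?thesis
    by (simp add: ly_hom_def linear_\<gamma>)
qed

end

section \<open>Extensibility\<close>

context ly_extension_pair
begin

lemma compatible_if_extensible:
  assumes "extensible E i p (\<alpha>, \<beta>)"
  shows "\<exists>\<phi>. Vector_Spaces.linear (scal G) (scal H) \<phi> \<and> compatible \<phi>"
proof -
  from assms obtain \<gamma> where \<gamma>: "ly_hom E E \<gamma>"
    and "i \<circ> \<beta> = \<gamma> \<circ> i" and "p \<circ> \<gamma> = \<alpha> \<circ> p"
    by (auto simp: extensible_def ly_aut_preserving_def ly_aut_def)
  then have \<gamma>_i: "\<gamma> (i a) = i (\<beta> a)" and p_\<gamma>: "p (\<gamma> e) = \<alpha> (p e)" for a e
    by (metis comp_apply)+
  have lin: "Vector_Spaces.linear (scal E) (scal E) \<gamma>"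
    using \<gamma> by (simp add: ly_hom_def)
  interpret \<gamma>: Vector_Spaces.linear "scal E" "scal E" \<gamma>
    by (rule lin)
  define \<phi> where "\<phi> x = inv i (s (\<alpha> x) - \<gamma> (s x))" for x
  have i_\<phi>: "i (\<phi> x) = s (\<alpha> x) - \<gamma> (s x)" for x
    unfolding \<phi>_def by (rule i_inv_i) (simp add: p.diff p_\<gamma>)
  have "Vector_Spaces.linear (scal G) (scal H) \<phi>"
    unfolding Vector_Spaces.linear_iff
  proof (intro conjI allI)
    fix x y c
    show "\<phi> (x + y) = \<phi> x + \<phi> y"
      by (simp add: i_\<phi> i.add s.add \<alpha>.add \<gamma>.add flip: i_eq_iff)
    show "\<phi> (scal G c x) = scal H c (\<phi> x)"
      by (simp add: i_\<phi> i.scale s.scale \<alpha>.scale \<gamma>.scale E.scal_diff flip: i_eq_iff)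
  qed (rule G.vector_space H.vector_space)+
  moreover interpret ly_lift H E G i p s \<chi> \<omega> \<mu> \<theta> D \<rho> T \<alpha> \<beta> \<phi> \<gamma>
    by (intro ly_lift.intro ly_lift_axioms.intro ly_extension_pair_axioms)
      (simp_all add: \<gamma>_i i_\<phi> lin)
  have "compatible \<phi>"
    using \<gamma> by (rule compatible_if_hom)
  ultimately show ?thesis
    by blast
qed

lemma extensible_if_compatible:
  assumes \<phi>: "Vector_Spaces.linear (scal G) (scal H) \<phi>" and "compatible \<phi>"
  shows "extensible E i p (\<alpha>, \<beta>)"
proof -
  interpret \<phi>: Vector_Spaces.linear "scal G" "scal H" \<phi>
    by (rule \<phi>)
  \<comment> \<open>The projection onto the kernel along the image of the section.\<close>
  define r where "r e = inv i (e - s (p e))" for e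
  have i_r: "i (r e) = e - s (p e)" for e
    unfolding r_def by (rule i_inv_i) (simp add: p.diff)
  have r_add: "r (e + e') = r e + r e'" for e e'
    by (simp add: i_r i.add p.add s.add flip: i_eq_iff)
  have r_scale: "r (scal E c e) = scal H c (r e)" for c e
    by (simp add: i_r i.scale p.scale s.scale E.scal_diff flip: i_eq_iff)
  have r_i: "r (i a) = a" and r_s: "r (s x) = 0" for a x
    by (simp_all add: i_r flip: i_eq_iff)
  define \<gamma> where "\<gamma> e = s (\<alpha> (p e)) - i (\<phi> (p e)) + i (\<beta> (r e))" for e
  have "Vector_Spaces.linear (scal E) (scal E) \<gamma>"
    unfolding Vector_Spaces.linear_iff
  proof (intro conjI allI)
    fix e e' c
    show "\<gamma> (e + e') = \<gamma> e + \<gamma> e'"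
      by (simp add: \<gamma>_def r_add i.add p.add s.add \<alpha>.add \<beta>.add \<phi>.add)
    show "\<gamma> (scal E c e) = scal E c (\<gamma> e)"
      by (simp add: \<gamma>_def r_scale i.scale p.scale s.scale \<alpha>.scale \<beta>.scale \<phi>.scale
          E.scal_diff E.scal_add)
  qed (rule E.vector_space)+
  then interpret ly_lift H E G i p s \<chi> \<omega> \<mu> \<theta> D \<rho> T \<alpha> \<beta> \<phi> \<gamma>
    by (intro ly_lift.intro ly_lift_axioms.intro ly_extension_pair_axioms)
      (simp_all add: \<gamma>_def r_i r_s)
  have "\<gamma> \<in> ly_aut_preserving E (range i)"
    using hom_if_compatible[OF \<open>compatible \<phi>\<close>] bij_\<gamma> \<gamma>_image
    by (simp add: ly_aut_preserving_def ly_aut_def)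
  moreover have "i \<circ> \<beta> = \<gamma> \<circ> i" and "p \<circ> \<gamma> = \<alpha> \<circ> p"
    by (simp_all add: fun_eq_iff \<gamma>_i p_\<gamma>)
  ultimately show ?thesis
    by (auto simp: extensible_def)
qed

end

theorem theorem5p2:
  fixes H :: "('k::field, 'h::ab_group_add) lya"
    and E :: "('k, 'e::ab_group_add) lya"
    and G :: "('k, 'g::ab_group_add) lya"
    and i :: "'h \<Rightarrow> 'e" and p :: "'e \<Rightarrow> 'g" and s :: "'g \<Rightarrow> 'e"
    and \<alpha> :: "'g \<Rightarrow> 'g" and \<beta> :: "'h \<Rightarrow> 'h"
  assumes "ly_extension H E G i p"
    and "ly_section E G p s"
    and "(\<chi>, \<omega>, \<mu>, \<theta>, D, \<rho>, T) = induced_cocycle E G i s"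
    and "(\<alpha>, \<beta>) \<in> ly_aut G \<times> ly_aut H"
  shows "extensible E i p (\<alpha>, \<beta>) \<longleftrightarrow>
    (\<exists>\<phi>. Vector_Spaces.linear (scal G) (scal H) \<phi> \<and>
      (\<forall>x y z a b.
        \<beta> (\<omega> x y z) - \<omega> (\<alpha> x) (\<alpha> y) (\<alpha> z) =
          T (\<alpha> z) (\<phi> x) (\<phi> y) - \<rho> (\<alpha> y) (\<phi> x) (\<phi> z) - \<theta> (\<alpha> y) (\<alpha> z) (\<phi> x)
          + \<rho> (\<alpha> x) (\<phi> y) (\<phi> z) + \<theta> (\<alpha> x) (\<alpha> z) (\<phi> y) - D (\<alpha> x) (\<alpha> y) (\<phi> z)
          + \<phi> (triple G x y z) - triple H (\<phi> x) (\<phi> y) (\<phi> z) \<and>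
        \<beta> (\<chi> x y) - \<chi> (\<alpha> x) (\<alpha> y) =
          bracket H (\<phi> x) (\<phi> y) + \<phi> (bracket G x y) - \<mu> (\<alpha> x) (\<phi> y) + \<mu> (\<alpha> y) (\<phi> x) \<and>
        \<beta> (\<theta> x y a) - \<theta> (\<alpha> x) (\<alpha> y) (\<beta> a) =
          triple H (\<beta> a) (\<phi> x) (\<phi> y) - T (\<alpha> y) (\<beta> a) (\<phi> x) + \<rho> (\<alpha> x) (\<beta> a) (\<phi> y) \<and>
        \<beta> (D x y a) - D (\<alpha> x) (\<alpha> y) (\<beta> a) =
          triple H (\<phi> x) (\<phi> y) (\<beta> a) - \<rho> (\<alpha> x) (\<phi> y) (\<beta> a) + \<rho> (\<alpha> y) (\<phi> x) (\<beta> a) \<and>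
        \<beta> (\<rho> x a b) - \<rho> (\<alpha> x) (\<beta> a) (\<beta> b) = triple H (\<beta> a) (\<phi> x) (\<beta> b) \<and>
        \<beta> (T x a b) - T (\<alpha> x) (\<beta> a) (\<beta> b) = triple H (\<beta> b) (\<beta> a) (\<phi> x) \<and>
        \<beta> (\<mu> x a) - \<mu> (\<alpha> x) (\<beta> a) = bracket H (\<beta> a) (\<phi> x)))"
proof -
  interpret ly_extension_pair H E G i p s \<chi> \<omega> \<mu> \<theta> D \<rho> T \<alpha> \<beta>
    using assms by (intro ly_extension_pair.intro ly_extension_pair_axioms.intro) auto
  show ?thesis
    unfolding compatible_def[symmetric]
    using compatible_if_extensible extensible_if_compatible by blast
qed

end
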